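(* Let $k$ be an algebraically closed field, let $Q$, $Q'$ be finite, connected, acyclic quivers, and let $\bar f=(f,f'):\bar V=(V,V',\psi)\to\bar W=(W,W',\psi')$ be a morphism in the category $Rep_{(Q,Q')}$ of birepresentations. Let $(K,\eta)$ and $(K',\eta')$ be the cokernels of $f$ and $f'$ in $Rep_k(Q)$ and $Rep_k(Q')$ respectively, realized vertexwise as $K_i=W_i/f_i(V_i)$ and $K'_{i'}=W'_{i'}/f'_{i'}(V'_{i'})$ with $\eta,\eta'$ the projections. For all arrows $\alpha$ of $Q$ and $\beta$ of $Q'$, let ${\psi''}^\alpha_\beta:K_{t(\alpha)}\to K'_{s(\beta)}$ be the (well-defined) $k$-linear map $${\psi''}^\alpha_\beta\big(w+f_{t(\alpha)}(V_{t(\alpha)})\big)={\psi'}^\alpha_\beta(w)+f'_{s(\beta)}(V'_{s(\beta)}),\qquad w\in W_{t(\alpha)}.$$ Set $\bar K=(K,K',\psi'')$ and $\bar\eta=(\eta,\eta')$. Then the pair $(\bar K,\bar\eta)$ is the cokernel of $\bar f$ in $Rep_{(Q,Q')}$.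
   Context: Write $Q=(\mathsf{Q}_0,\mathsf{Q}_1,s,t)$ and $Q'=(\mathsf{Q}'_0,\mathsf{Q}'_1,s,t)$, with vertex sets, arrow sets, and source and target maps $s,t$. For a quiver $Q$, $Rep_k(Q)$ denotes the category of $k$-linear representations of $Q$ (a $k$-vector space $M_i$ for each vertex $i$, of arbitrary dimension, and a $k$-linear map $M_{s(\alpha)}\to M_{t(\alpha)}$ for each arrow $\alpha$; morphisms are families of linear maps, one per vertex, commuting with the arrow maps). A birepresentation ($2$-representation) of $(Q,Q')$ is a triple $\bar V=(V,V',\psi)$, where $V\in Rep_k(Q)$, $V'\in Rep_k(Q')$, and $\psi=(\psi^\alpha_\beta)$ is a collection of $k$-linear maps $\psi^\alpha_\beta:V_{t(\alpha)}\to V'_{s(\beta)}$, one for each pair of arrows $(\alpha,\beta)\in\mathsf{Q}_1\times\mathsf{Q}'_1$. No compatibility between $\psi$ and the arrow maps is required. A morphism $(V,V',\psi)\to(W,W',\psi')$ is a pair $(f,f')$, where $f:V\to W$ is a morphism in $Rep_k(Q)$ and $f':V'\to W'$ is a morphism in $Rep_k(Q')$, such that $f'_{s(\beta)}\circ\psi^\alpha_\beta={\psi'}^\alpha_\beta\circ f_{t(\alpha)}$ for all $(\alpha,\beta)\in\mathsf{Q}_1\times\mathsf{Q}'_1$. Composition and identities are componentwise. This defines the category $Rep_{(Q,Q')}$. The cokernel of a morphism $f:A\to B$ in a category with zero object is a morphism $p:B\to C$ (written as the pair $(C,p)$) such that $p\circ f=0$ and every $g:B\to D$ with $g\circ f=0$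 factors as $g=h\circ p$ for a unique $h:C\to D$. The arrow maps of the cokernel representations $K,K'$ are those induced by the arrow maps of $W,W'$ on the quotients. *)

theory Defs
  imports
    "HOL-Algebra.Algebraic_Closure"
    "Graph_Theory.Arc_Walk"
    "Graph_Theory.Digraph_Component"
begin

text \<open>
  A quiver is a \<^typ>\<open>('v, 'e) pre_digraph\<close> (parallel arrows and loops are allowed); source and
  target are \<^const>\<open>tail\<close> and \<^const>\<open>head\<close>. The predicate \<^const>\<open>connected\<close> refers to the
  underlying undirected graph and excludes the empty quiver, whereas \<^const>\<open>pre_digraph.cycle\<close>
  is about directed cycles, loops included.
\<close>

definition finite_connected_acyclic_quiver :: "('v, 'e) pre_digraph \<Rightarrow> bool" where
  "finite_connected_acyclic_quiver Q \<longleftrightarrow>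
     fin_digraph Q \<and> connected Q \<and> (\<nexists>p. pre_digraph.cycle Q p)"


section \<open>Linear maps and quotient spaces\<close>

text \<open>
  A vector space over a field \<open>k\<close> is a \<^term>\<open>module k M\<close>; the ring fields \<^const>\<open>monoid.mult\<close> and
  \<^const>\<open>one\<close> of the record \<open>M\<close> play no role. Linear maps are extensional functions (equal to
  \<^const>\<open>undefined\<close> off the domain), so that equality in HOL is equality of maps.
\<close>

definition linear_maps ::
    "('r, 'm) ring_scheme \<Rightarrow> ('r, 'a) module \<Rightarrow> ('r, 'b) module \<Rightarrow> ('a \<Rightarrow> 'b) set" where
  "linear_maps k M N =
     {g \<in> carrier M \<rightarrow>\<^sub>E carrier N.
        (\<forall>x\<in>carrier M. \<forall>y\<in>carrier M. g (x \<oplus>\<^bsub>M\<^esub> y) = g x \<oplus>\<^bsub>N\<^esub> g y) \<and>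
        (\<forall>a\<in>carrier k. \<forall>x\<in>carrier M. g (a \<odot>\<^bsub>M\<^esub> x) = a \<odot>\<^bsub>N\<^esub> g x)}"

definition quot_module :: "('r, 'a) module \<Rightarrow> 'a set \<Rightarrow> ('r, 'a set) module" where
  "quot_module M U =
     \<lparr>carrier = a_rcosets\<^bsub>M\<^esub> U, monoid.mult = undefined, one = undefined,
      zero = U, add = set_add M,
      smult = (\<lambda>a A. \<Union>x\<in>A. U +>\<^bsub>M\<^esub> (a \<odot>\<^bsub>M\<^esub> x))\<rparr>"

text \<open>
  The map \<open>x + U \<mapsto> g x + U'\<close> induced by \<open>g : M \<rightarrow> N\<close> when \<open>g\<close> maps \<open>U\<close> into \<open>U'\<close>: the union is
  then over copies of one and the same coset, see \<open>quot_map_coset\<close> below.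
\<close>

definition quot_map ::
    "('r, 'a) module \<Rightarrow> 'a set \<Rightarrow> ('r, 'b) module \<Rightarrow> 'b set \<Rightarrow> ('a \<Rightarrow> 'b) \<Rightarrow> 'a set \<Rightarrow> 'b set" where
  "quot_map M U N U' g = (\<lambda>A\<in>carrier (quot_module M U). \<Union>x\<in>A. U' +>\<^bsub>N\<^esub> g x)"


section \<open>Representations of a quiver\<close>

record ('v, 'e, 'r, 'a) qrep =
  space_at :: "'v \<Rightarrow> ('r, 'a) module"
  map_at :: "'e \<Rightarrow> 'a \<Rightarrow> 'a"

definition quiver_rep ::
    "('r, 'm) ring_scheme \<Rightarrow> ('v, 'e) pre_digraph \<Rightarrow> ('v, 'e, 'r, 'a) qrep \<Rightarrow> bool" where
  "quiver_rep k Q M \<longleftrightarrow>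
     (\<forall>i\<in>verts Q. module k (space_at M i)) \<and>
     (\<forall>\<alpha>\<in>arcs Q. map_at M \<alpha> \<in> linear_maps k (space_at M (tail Q \<alpha>)) (space_at M (head Q \<alpha>)))"

definition rep_hom ::
    "('r, 'm) ring_scheme \<Rightarrow> ('v, 'e) pre_digraph \<Rightarrow> ('v, 'e, 'r, 'a) qrep \<Rightarrow>
     ('v, 'e, 'r, 'b) qrep \<Rightarrow> ('v \<Rightarrow> 'a \<Rightarrow> 'b) set" where
  "rep_hom k Q M N =
     {f \<in> (\<Pi>\<^sub>E i\<in>verts Q. linear_maps k (space_at M i) (space_at N i)).
        \<forall>\<alpha>\<in>arcs Q. \<forall>x\<in>carrier (space_at M (tail Q \<alpha>)).
          f (head Q \<alpha>) (map_at M \<alpha> x) = map_at N \<alpha> (f (tail Q \<alpha>) x)}"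

text \<open>The argument \<open>M\<close> is the domain of \<open>f\<close>.\<close>

definition rep_comp ::
    "('v, 'e) pre_digraph \<Rightarrow> ('v, 'e, 'r, 'a) qrep \<Rightarrow> ('v \<Rightarrow> 'b \<Rightarrow> 'c) \<Rightarrow> ('v \<Rightarrow> 'a \<Rightarrow> 'b) \<Rightarrow>
     'v \<Rightarrow> 'a \<Rightarrow> 'c" where
  "rep_comp Q M g f = (\<lambda>i\<in>verts Q. compose (carrier (space_at M i)) (g i) (f i))"

definition rep_zero ::
    "('v, 'e) pre_digraph \<Rightarrow> ('v, 'e, 'r, 'a) qrep \<Rightarrow> ('v, 'e, 'r, 'b) qrep \<Rightarrow>
     'v \<Rightarrow> 'a \<Rightarrow> 'b" where
  "rep_zero Q M N = (\<lambda>i\<in>verts Q. \<lambda>x\<in>carrier (space_at M i). \<zero>\<^bsub>space_at N i\<^esub>)"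

abbreviation image_at ::
    "('v, 'e, 'r, 'a) qrep \<Rightarrow> ('v \<Rightarrow> 'a \<Rightarrow> 'b) \<Rightarrow> 'v \<Rightarrow> 'b set" where
  "image_at V f i \<equiv> f i ` carrier (space_at V i)"

definition coker_rep ::
    "('v, 'e) pre_digraph \<Rightarrow> ('v, 'e, 'r, 'a) qrep \<Rightarrow> ('v, 'e, 'r, 'b) qrep \<Rightarrow>
     ('v \<Rightarrow> 'a \<Rightarrow> 'b) \<Rightarrow> ('v, 'e, 'r, 'b set) qrep" where
  "coker_rep Q V W f =
     \<lparr>space_at = (\<lambda>i. quot_module (space_at W i) (image_at V f i)),
      map_at = (\<lambda>\<alpha>. quot_map (space_at W (tail Q \<alpha>)) (image_at V f (tail Q \<alpha>))
                              (space_at W (head Q \<alpha>)) (image_at V f (head Q \<alpha>)) (map_at W \<alpha>))\<rparr>"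

definition coker_proj ::
    "('v, 'e) pre_digraph \<Rightarrow> ('v, 'e, 'r, 'a) qrep \<Rightarrow> ('v, 'e, 'r, 'b) qrep \<Rightarrow>
     ('v \<Rightarrow> 'a \<Rightarrow> 'b) \<Rightarrow> 'v \<Rightarrow> 'b \<Rightarrow> 'b set" where
  "coker_proj Q V W f =
     (\<lambda>i\<in>verts Q. \<lambda>w\<in>carrier (space_at W i). image_at V f i +>\<^bsub>space_at W i\<^esub> w)"


section \<open>Birepresentations\<close>

record ('v, 'e, 'v2, 'e2, 'r, 'a, 'a2) birep =
  rep1 :: "('v, 'e, 'r, 'a) qrep"
  rep2 :: "('v2, 'e2, 'r, 'a2) qrep"
  psi :: "'e \<Rightarrow> 'e2 \<Rightarrow> 'a \<Rightarrow> 'a2"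

definition birepresentation ::
    "('r, 'm) ring_scheme \<Rightarrow> ('v, 'e) pre_digraph \<Rightarrow> ('v2, 'e2) pre_digraph \<Rightarrow>
     ('v, 'e, 'v2, 'e2, 'r, 'a, 'a2) birep \<Rightarrow> bool" where
  "birepresentation k Q Q' V \<longleftrightarrow>
     quiver_rep k Q (rep1 V) \<and> quiver_rep k Q' (rep2 V) \<and>
     (\<forall>\<alpha>\<in>arcs Q. \<forall>\<beta>\<in>arcs Q'.
        psi V \<alpha> \<beta> \<in> linear_maps k (space_at (rep1 V) (head Q \<alpha>)) (space_at (rep2 V) (tail Q' \<beta>)))"

definition birep_hom ::
    "('r, 'm) ring_scheme \<Rightarrow> ('v, 'e) pre_digraph \<Rightarrow> ('v2, 'e2) pre_digraph \<Rightarrow>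
     ('v, 'e, 'v2, 'e2, 'r, 'a, 'a2) birep \<Rightarrow> ('v, 'e, 'v2, 'e2, 'r, 'b, 'b2) birep \<Rightarrow>
     (('v \<Rightarrow> 'a \<Rightarrow> 'b) \<times> ('v2 \<Rightarrow> 'a2 \<Rightarrow> 'b2)) set" where
  "birep_hom k Q Q' V W =
     {(f, f'). f \<in> rep_hom k Q (rep1 V) (rep1 W) \<and> f' \<in> rep_hom k Q' (rep2 V) (rep2 W) \<and>
        (\<forall>\<alpha>\<in>arcs Q. \<forall>\<beta>\<in>arcs Q'. \<forall>x\<in>carrier (space_at (rep1 V) (head Q \<alpha>)).
           f' (tail Q' \<beta>) (psi V \<alpha> \<beta> x) = psi W \<alpha> \<beta> (f (head Q \<alpha>) x))}"

definition birep_comp ::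
    "('v, 'e) pre_digraph \<Rightarrow> ('v2, 'e2) pre_digraph \<Rightarrow>
     ('v, 'e, 'v2, 'e2, 'r, 'a, 'a2) birep \<Rightarrow>
     ('v \<Rightarrow> 'b \<Rightarrow> 'c) \<times> ('v2 \<Rightarrow> 'b2 \<Rightarrow> 'c2) \<Rightarrow> ('v \<Rightarrow> 'a \<Rightarrow> 'b) \<times> ('v2 \<Rightarrow> 'a2 \<Rightarrow> 'b2) \<Rightarrow>
     ('v \<Rightarrow> 'a \<Rightarrow> 'c) \<times> ('v2 \<Rightarrow> 'a2 \<Rightarrow> 'c2)" where
  "birep_comp Q Q' V g f =
     (rep_comp Q (rep1 V) (fst g) (fst f), rep_comp Q' (rep2 V) (snd g) (snd f))"

definition birep_zero ::
    "('v, 'e) pre_digraph \<Rightarrow> ('v2, 'e2) pre_digraph \<Rightarrow>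
     ('v, 'e, 'v2, 'e2, 'r, 'a, 'a2) birep \<Rightarrow> ('v, 'e, 'v2, 'e2, 'r, 'b, 'b2) birep \<Rightarrow>
     ('v \<Rightarrow> 'a \<Rightarrow> 'b) \<times> ('v2 \<Rightarrow> 'a2 \<Rightarrow> 'b2)" where
  "birep_zero Q Q' V W = (rep_zero Q (rep1 V) (rep1 W), rep_zero Q' (rep2 V) (rep2 W))"

text \<open>
  Cokernels in the category of birepresentations. A definition cannot quantify over types, so the
  element types \<open>'d\<close>, \<open>'d2\<close> of the test objects \<open>D\<close> are parameters: being the cokernel of \<open>f\<close> means
  that the predicate holds for all types \<open>'d\<close>, \<open>'d2\<close>, and a theorem with these type variables free
  in its conclusion asserts precisely that. The spaces at the vertices of one representation are
  subsets of a common type; up to isomorphism this is no restriction.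
\<close>

definition is_birep_cokernel ::
    "'d itself \<Rightarrow> 'd2 itself \<Rightarrow>
     ('r, 'm) ring_scheme \<Rightarrow> ('v, 'e) pre_digraph \<Rightarrow> ('v2, 'e2) pre_digraph \<Rightarrow>
     ('v, 'e, 'v2, 'e2, 'r, 'a, 'a2) birep \<Rightarrow> ('v, 'e, 'v2, 'e2, 'r, 'b, 'b2) birep \<Rightarrow>
     ('v \<Rightarrow> 'a \<Rightarrow> 'b) \<times> ('v2 \<Rightarrow> 'a2 \<Rightarrow> 'b2) \<Rightarrow>
     ('v, 'e, 'v2, 'e2, 'r, 'c, 'c2) birep \<Rightarrow> ('v \<Rightarrow> 'b \<Rightarrow> 'c) \<times> ('v2 \<Rightarrow> 'b2 \<Rightarrow> 'c2) \<Rightarrow> bool" where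
  "is_birep_cokernel _ _ k Q Q' V W f C p \<longleftrightarrow>
     birepresentation k Q Q' C \<and> p \<in> birep_hom k Q Q' W C \<and>
     birep_comp Q Q' V p f = birep_zero Q Q' V C \<and>
     (\<forall>D :: ('v, 'e, 'v2, 'e2, 'r, 'd, 'd2) birep. birepresentation k Q Q' D \<longrightarrow>
        (\<forall>g\<in>birep_hom k Q Q' W D. birep_comp Q Q' V g f = birep_zero Q Q' V D \<longrightarrow>
           (\<exists>!h. h \<in> birep_hom k Q Q' C D \<and> g = birep_comp Q Q' W h p)))"

definition coker_birep ::
    "('v, 'e) pre_digraph \<Rightarrow> ('v2, 'e2) pre_digraph \<Rightarrow>
     ('v, 'e, 'v2, 'e2, 'r, 'a, 'a2) birep \<Rightarrow> ('v, 'e, 'v2, 'e2, 'r, 'b, 'b2) birep \<Rightarrow>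
     ('v \<Rightarrow> 'a \<Rightarrow> 'b) \<Rightarrow> ('v2 \<Rightarrow> 'a2 \<Rightarrow> 'b2) \<Rightarrow>
     ('v, 'e, 'v2, 'e2, 'r, 'b set, 'b2 set) birep" where
  "coker_birep Q Q' V W f f' =
     \<lparr>rep1 = coker_rep Q (rep1 V) (rep1 W) f,
      rep2 = coker_rep Q' (rep2 V) (rep2 W) f',
      psi = (\<lambda>\<alpha> \<beta>.
        quot_map (space_at (rep1 W) (head Q \<alpha>)) (image_at (rep1 V) f (head Q \<alpha>))
                 (space_at (rep2 W) (tail Q' \<beta>)) (image_at (rep2 V) f' (tail Q' \<beta>))
                 (psi W \<alpha> \<beta>))\<rparr>"


section \<open>Well-definedness of the induced maps\<close>

lemma linear_mapsD:
  fixes M :: "('r, 'a) module" and N :: "('r, 'b) module"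
  assumes "g \<in> linear_maps k M N"
  shows "x \<in> carrier M \<Longrightarrow> g x \<in> carrier N"
    and "x \<in> carrier M \<Longrightarrow> y \<in> carrier M \<Longrightarrow> g (x \<oplus>\<^bsub>M\<^esub> y) = g x \<oplus>\<^bsub>N\<^esub> g y"
    and "a \<in> carrier k \<Longrightarrow> x \<in> carrier M \<Longrightarrow> g (a \<odot>\<^bsub>M\<^esub> x) = a \<odot>\<^bsub>N\<^esub> g x"
  using assms by (auto simp: linear_maps_def)

lemma linear_maps_image_submodule:
  assumes "module k M" "module k N" "g \<in> linear_maps k M N"
  shows "submodule (g ` carrier M) k N"
proof -
  interpret M: module k M by fact
  interpret N: module k N by fact
  note g = linear_mapsD[OF assms(3)]
  have "group_hom (add_monoid M) (add_monoid N) g"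
    by (intro group_hom.intro M.a_group N.a_group group_hom_axioms.intro) (auto simp: hom_def g)
  then interpret h: abelian_group_hom M N g
    by (intro abelian_group_hom.intro abelian_group_hom_axioms.intro M.abelian_group_axioms
        N.abelian_group_axioms)
  show ?thesis
  proof (rule N.submoduleI)
    show "\<zero>\<^bsub>N\<^esub> \<in> g ` carrier M" by (rule image_eqI[of _ g "\<zero>\<^bsub>M\<^esub>"]) simp_all
    show "\<ominus>\<^bsub>N\<^esub> y \<in> g ` carrier M" if "y \<in> g ` carrier M" for y
      using that by (auto simp flip: h.hom_a_inv)
    show "y \<oplus>\<^bsub>N\<^esub> z \<in> g ` carrier M" if "y \<in> g ` carrier M" "z \<in> g ` carrier M" for y z
      using that by (auto simp flip: g(2))
    show "a \<odot>\<^bsub>N\<^esub> y \<in> g ` carrier M" if "a \<in> carrier k" "y \<in> g ` carrier M" for a y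
      using that by (auto simp flip: g(3))
  qed (use g(1) in auto)
qed

lemma submodule_imp_abelian_subgroup:
  "module k M \<Longrightarrow> submodule U k M \<Longrightarrow> abelian_subgroup U M"
  by (simp add: abelian_subgroupI3 additive_subgroupI module_def submodule_def)

lemma quot_map_coset:
  assumes M: "module k M" and N: "module k N" and U: "submodule U k M" and U': "submodule U' k N"
    and g: "g \<in> linear_maps k M N" and sub: "g ` U \<subseteq> U'" and x: "x \<in> carrier M"
  shows "quot_map M U N U' g (U +>\<^bsub>M\<^esub> x) = U' +>\<^bsub>N\<^esub> g x"
proof -
  interpret U: abelian_subgroup U M using M U by (rule submodule_imp_abelian_subgroup)
  interpret U': abelian_subgroup U' N using N U' by (rule submodule_imp_abelian_subgroup)
  have eq: "U' +>\<^bsub>N\<^esub> g y = U' +>\<^bsub>N\<^esub> g x" if y: "y \<in> U +>\<^bsub>M\<^esub> x" for y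
  proof -
    obtain u where u: "u \<in> U" "y = u \<oplus>\<^bsub>M\<^esub> x" using y by (auto simp: a_r_coset_def')
    then have "g y = g u \<oplus>\<^bsub>N\<^esub> g x" using U.a_subset x linear_mapsD(2)[OF g] by blast
    moreover have "g u \<in> U'" using sub u by auto
    ultimately have "g y \<in> U' +>\<^bsub>N\<^esub> g x" by (auto simp: a_r_coset_def')
    then show ?thesis
      using U'.a_repr_independence[OF _ linear_mapsD(1)[OF g x] U'.a_subgroup] by simp
  qed
  have "(\<Union>y\<in>U +>\<^bsub>M\<^esub> x. U' +>\<^bsub>N\<^esub> g y) = U' +>\<^bsub>N\<^esub> g x"
    using eq by (intro UN_constant_eq[OF U.a_rcos_self[OF x]] ballI)
  moreover have "U +>\<^bsub>M\<^esub> x \<in> carrier (quot_module M U)"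
    using U.a_rcosetsI[OF U.a_subset x] by (simp add: quot_module_def)
  ultimately show ?thesis by (simp add: quot_map_def)
qed

lemma psi_coker_birep:
  assumes Q: "fin_digraph Q" "fin_digraph Q'"
    and V: "birepresentation k Q Q' V" and W: "birepresentation k Q Q' W"
    and f: "(f, f') \<in> birep_hom k Q Q' V W"
    and \<alpha>: "\<alpha> \<in> arcs Q" and \<beta>: "\<beta> \<in> arcs Q'" and w: "w \<in> carrier (space_at (rep1 W) (head Q \<alpha>))"
  shows "psi (coker_birep Q Q' V W f f') \<alpha> \<beta>
           (image_at (rep1 V) f (head Q \<alpha>) +>\<^bsub>space_at (rep1 W) (head Q \<alpha>)\<^esub> w) =
         image_at (rep2 V) f' (tail Q' \<beta>) +>\<^bsub>space_at (rep2 W) (tail Q' \<beta>)\<^esub> psi W \<alpha> \<beta> w"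
proof -
  interpret Q: fin_digraph Q by fact
  interpret Q': fin_digraph Q' by fact
  have verts: "head Q \<alpha> \<in> verts Q" "tail Q' \<beta> \<in> verts Q'" using \<alpha> \<beta> by auto
  have mods: "module k (space_at (rep1 V) (head Q \<alpha>))" "module k (space_at (rep2 V) (tail Q' \<beta>))"
    "module k (space_at (rep1 W) (head Q \<alpha>))" "module k (space_at (rep2 W) (tail Q' \<beta>))"
    using V W verts by (auto simp: birepresentation_def quiver_rep_def)
  have lin: "f (head Q \<alpha>) \<in> linear_maps k (space_at (rep1 V) (head Q \<alpha>)) (space_at (rep1 W) (head Q \<alpha>))"
    "f' (tail Q' \<beta>) \<in> linear_maps k (space_at (rep2 V) (tail Q' \<beta>)) (space_at (rep2 W) (tail Q' \<beta>))"
    using f verts by (auto simp: birep_hom_def rep_hom_def)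
  have psi: "psi V \<alpha> \<beta> x \<in> carrier (space_at (rep2 V) (tail Q' \<beta>))"
    if "x \<in> carrier (space_at (rep1 V) (head Q \<alpha>))" for x
    using V \<alpha> \<beta> that by (auto simp: birepresentation_def dest: linear_mapsD(1))
  show ?thesis
    unfolding coker_birep_def birep.simps
  proof (rule quot_map_coset[OF mods(3,4) _ _ _ _ w])
    show "psi W \<alpha> \<beta> ` image_at (rep1 V) f (head Q \<alpha>) \<subseteq> image_at (rep2 V) f' (tail Q' \<beta>)"
    proof clarify
      fix x assume x: "x \<in> carrier (space_at (rep1 V) (head Q \<alpha>))"
      then have "psi W \<alpha> \<beta> (f (head Q \<alpha>) x) = f' (tail Q' \<beta>) (psi V \<alpha> \<beta> x)"
        using f \<alpha> \<beta> by (auto simp: birep_hom_def)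
      then show "psi W \<alpha> \<beta> (f (head Q \<alpha>) x) \<in> image_at (rep2 V) f' (tail Q' \<beta>)"
        using psi[OF x] by auto
    qed
  qed (use mods lin linear_maps_image_submodule W \<alpha> \<beta> in \<open>auto simp: birepresentation_def\<close>)
qed

end

theory Submission
  imports Defs
begin

text \<open>
  Cokernels of birepresentations are computed in each of the two components, and within a component
  vertex by vertex. All maps in sight are pinned down by their values on cosets: a quotient space
  \<open>M / U\<close> consists of the cosets \<open>U + x\<close>, so two linear maps out of it agree as soon as
  they agree on cosets (\<open>linear_map_quot_eqI\<close>), and an extensional map out of it is linear as
  soon as its composite with the projection is (\<open>linear_map_quotI\<close>).

  For a single quiver, a morphism \<open>g : W \<rightarrow> D\<close> with \<open>g \<circ> f = 0\<close> vanishes on the image of \<open>f\<close>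
  at every vertex, so \<open>w + im f \<mapsto> g w\<close> is well defined; it commutes with the arrow maps because
  \<open>g\<close> does and the arrow maps of the cokernel send \<open>w + im f\<close> to \<open>W\<^sub>\<alpha> w + im f\<close>
  (\<open>coker_rep_lift\<close>). It is the only factorisation since the projection is surjective at every
  vertex (\<open>coker_proj_epi\<close>).

  The linking maps of the cokernel are induced by those of \<open>W\<close>, which send the image of \<open>f\<close> into
  that of \<open>f'\<close>. The two factorisations \<open>h\<close>, \<open>h'\<close> of a morphism
  \<open>(g, g')\<close> of birepresentations have to commute with \<open>\<psi>\<close>, and at the coset of \<open>w\<close> this is
  the identity \<open>g' (\<psi> w) = \<psi> (g w)\<close>, which holds because \<open>(g, g')\<close> is a morphism
  (\<open>coker_birep_lift\<close>). Uniqueness is inherited from the components.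
\<close>

section \<open>Quotient spaces\<close>

lemma linear_maps_extensional: "g \<in> linear_maps k M N \<Longrightarrow> g \<in> extensional (carrier M)"
  by (simp add: linear_maps_def PiE_def)

lemma linear_maps_compose:
  assumes M: "module k M" and g: "g \<in> linear_maps k M N" and h: "h \<in> linear_maps k N P"
  shows "compose (carrier M) h g \<in> linear_maps k M P"
proof -
  interpret M: module k M by (rule M)
  show ?thesis
    using linear_mapsD[OF g] linear_mapsD[OF h] by (simp add: linear_maps_def compose_def)
qed

lemma quot_module_zero: "\<zero>\<^bsub>quot_module M U\<^esub> = U"
  by (simp add: quot_module_def)

context
  fixes k :: "('r, 'm) ring_scheme" and M :: "('r, 'a) module" and U :: "'a set"
  assumes M: "module k M" and U: "submodule U k M"
begin

interpretation M: module k M by (rule M)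
interpretation U: submodule U k M by (rule U)
interpretation U: abelian_subgroup U M by (rule submodule_imp_abelian_subgroup[OF M U])

lemma quot_module_carrier:
  "carrier (quot_module M U) = (\<lambda>x. U +>\<^bsub>M\<^esub> x) ` carrier M"
  by (auto simp: quot_module_def A_RCOSETS_def')

lemma quot_module_add:
  assumes "x \<in> carrier M" "y \<in> carrier M"
  shows "(U +>\<^bsub>M\<^esub> x) \<oplus>\<^bsub>quot_module M U\<^esub> (U +>\<^bsub>M\<^esub> y) = U +>\<^bsub>M\<^esub> (x \<oplus>\<^bsub>M\<^esub> y)"
  using U.a_rcos_sum[OF assms] by (simp add: quot_module_def)

lemma quot_module_smult:
  assumes a: "a \<in> carrier k" and x: "x \<in> carrier M"
  shows "a \<odot>\<^bsub>quot_module M U\<^esub> (U +>\<^bsub>M\<^esub> x) = U +>\<^bsub>M\<^esub> (a \<odot>\<^bsub>M\<^esub> x)"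
proof -
  have "U +>\<^bsub>M\<^esub> (a \<odot>\<^bsub>M\<^esub> y) = U +>\<^bsub>M\<^esub> (a \<odot>\<^bsub>M\<^esub> x)" if y: "y \<in> U +>\<^bsub>M\<^esub> x" for y
  proof -
    obtain u where u: "u \<in> U" "y = u \<oplus>\<^bsub>M\<^esub> x" using y unfolding a_r_coset_def' by blast
    have "a \<odot>\<^bsub>M\<^esub> y = a \<odot>\<^bsub>M\<^esub> u \<oplus>\<^bsub>M\<^esub> a \<odot>\<^bsub>M\<^esub> x"
      unfolding u(2) by (rule M.smult_r_distr[OF a subsetD[OF U.a_subset u(1)] x])
    then have "a \<odot>\<^bsub>M\<^esub> y \<in> U +>\<^bsub>M\<^esub> (a \<odot>\<^bsub>M\<^esub> x)"
      using U.smult_closed[OF a u(1)] unfolding a_r_coset_def' by blast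
    then show ?thesis
      by (rule M.a_repr_independence[OF _ M.smult_closed[OF a x] U.a_subgroup, symmetric])
  qed
  then have "(\<Union>y\<in>U +>\<^bsub>M\<^esub> x. U +>\<^bsub>M\<^esub> (a \<odot>\<^bsub>M\<^esub> y)) = U +>\<^bsub>M\<^esub> (a \<odot>\<^bsub>M\<^esub> x)"
    by (intro UN_constant_eq[OF U.a_rcos_self[OF x]] ballI)
  then show ?thesis by (simp add: quot_module_def)
qed

lemma coset_eq_quot_zero_iff:
  assumes "x \<in> carrier M"
  shows "U +>\<^bsub>M\<^esub> x = \<zero>\<^bsub>quot_module M U\<^esub> \<longleftrightarrow> x \<in> U"
  unfolding quot_module_zero
  using M.a_coset_join2[OF assms U.a_subgroup] U.a_rcos_self[OF assms] by blast

lemma module_quot_module: "module k (quot_module M U)"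
proof -
  let ?K = "quot_module M U"
  note ops = quot_module_carrier quot_module_add quot_module_smult
  have zero: "\<zero>\<^bsub>?K\<^esub> = U +>\<^bsub>M\<^esub> \<zero>\<^bsub>M\<^esub>"
    using coset_eq_quot_zero_iff[of "\<zero>\<^bsub>M\<^esub>"] by simp
  have rep: "\<exists>x\<in>carrier M. A = U +>\<^bsub>M\<^esub> x" if "A \<in> carrier ?K" for A
    using that unfolding quot_module_carrier by blast
  show ?thesis
  proof (rule moduleI)
    show "abelian_group ?K"
    proof (rule abelian_groupI)
      show "\<zero>\<^bsub>?K\<^esub> \<in> carrier ?K" by (simp add: zero ops)
    next
      fix A B assume "A \<in> carrier ?K" "B \<in> carrier ?K"
      then obtain x y where "x \<in> carrier M" "A = U +>\<^bsub>M\<^esub> x" "y \<in> carrier M" "B = U +>\<^bsub>M\<^esub> y"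
        using rep by metis
      then show "A \<oplus>\<^bsub>?K\<^esub> B \<in> carrier ?K" "A \<oplus>\<^bsub>?K\<^esub> B = B \<oplus>\<^bsub>?K\<^esub> A"
        by (simp_all add: ops M.a_comm[of x y])
    next
      fix A B C assume "A \<in> carrier ?K" "B \<in> carrier ?K" "C \<in> carrier ?K"
      then obtain x y z where "x \<in> carrier M" "A = U +>\<^bsub>M\<^esub> x" "y \<in> carrier M" "B = U +>\<^bsub>M\<^esub> y"
        "z \<in> carrier M" "C = U +>\<^bsub>M\<^esub> z"
        using rep by metis
      then show "A \<oplus>\<^bsub>?K\<^esub> B \<oplus>\<^bsub>?K\<^esub> C = A \<oplus>\<^bsub>?K\<^esub> (B \<oplus>\<^bsub>?K\<^esub> C)"
        by (simp add: ops M.a_assoc)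
    next
      fix A assume "A \<in> carrier ?K"
      then obtain x where x: "x \<in> carrier M" "A = U +>\<^bsub>M\<^esub> x" using rep by metis
      then show "\<zero>\<^bsub>?K\<^esub> \<oplus>\<^bsub>?K\<^esub> A = A" by (simp add: ops zero)
      show "\<exists>B\<in>carrier ?K. B \<oplus>\<^bsub>?K\<^esub> A = \<zero>\<^bsub>?K\<^esub>"
        using x by (intro bexI[of _ "U +>\<^bsub>M\<^esub> (\<ominus>\<^bsub>M\<^esub> x)"]) (simp_all add: ops zero M.l_neg)
    qed
  qed (auto simp: ops M.R.is_cring M.smult_l_distr M.smult_r_distr M.smult_assoc1)
qed

lemma coset_map_linear:
  "(\<lambda>x\<in>carrier M. U +>\<^bsub>M\<^esub> x) \<in> linear_maps k M (quot_module M U)"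
  by (auto simp: linear_maps_def quot_module_carrier quot_module_add quot_module_smult)

text \<open>Linearity on a quotient can be tested after composition with the projection.\<close>

lemma linear_map_quotI:
  assumes g: "g \<in> linear_maps k M N" and h: "h \<in> extensional (carrier (quot_module M U))"
    and hg: "\<And>x. x \<in> carrier M \<Longrightarrow> h (U +>\<^bsub>M\<^esub> x) = g x"
  shows "h \<in> linear_maps k (quot_module M U) N"
  using linear_mapsD[OF g] h
  by (auto simp: linear_maps_def quot_module_carrier quot_module_add quot_module_smult hg PiE_def)

lemma linear_map_quot_eqI:
  assumes h: "h \<in> linear_maps k (quot_module M U) N" "h' \<in> linear_maps k (quot_module M U) N"
    and eq: "\<And>x. x \<in> carrier M \<Longrightarrow> h (U +>\<^bsub>M\<^esub> x) = h' (U +>\<^bsub>M\<^esub> x)"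
  shows "h = h'"
proof (rule extensionalityI)
  show "h \<in> extensional (carrier (quot_module M U))" "h' \<in> extensional (carrier (quot_module M U))"
    using h[THEN linear_maps_extensional] .
qed (auto simp: quot_module_carrier eq)

end

lemma quot_map_linear:
  fixes M :: "('r, 'a) module" and N :: "('r, 'b) module"
  assumes M: "module k M" and N: "module k N" and U: "submodule U k M" and U': "submodule U' k N"
    and g: "g \<in> linear_maps k M N" and sub: "g ` U \<subseteq> U'"
  shows "quot_map M U N U' g \<in> linear_maps k (quot_module M U) (quot_module N U')"
proof (rule linear_map_quotI[OF M U])
  \<comment> \<open>the composite with the projection of \<open>M\<close> is \<open>g\<close> followed by the projection of \<open>N\<close>\<close>
  show "compose (carrier M) (\<lambda>y\<in>carrier N. U' +>\<^bsub>N\<^esub> y) g \<in> linear_maps k M (quot_module N U')"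
    by (rule linear_maps_compose[OF M g coset_map_linear[OF N U']])
  show "quot_map M U N U' g \<in> extensional (carrier (quot_module M U))"
    by (simp add: quot_map_def)
  show "quot_map M U N U' g (U +>\<^bsub>M\<^esub> x) = compose (carrier M) (\<lambda>y\<in>carrier N. U' +>\<^bsub>N\<^esub> y) g x"
    if "x \<in> carrier M" for x
    using quot_map_coset[OF M N U U' g sub that] that linear_mapsD(1)[OF g that]
    by (simp add: compose_def)
qed

text \<open>
  The factorisation of \<open>g : M \<rightarrow> N\<close> through \<open>M / U\<close>, for \<open>g\<close> vanishing on \<open>U\<close>: its value at a
  coset is the only element of the image of that coset under \<open>g\<close>. In contrast to \<^const>\<open>quot_map\<close>,
  the target is \<open>N\<close> itself, not its quotient by the zero space.
\<close>

definition quot_lift :: "('r, 'a) module \<Rightarrow> 'a set \<Rightarrow> ('a \<Rightarrow> 'b) \<Rightarrow> 'a set \<Rightarrow> 'b" where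
  "quot_lift M U g = (\<lambda>A\<in>carrier (quot_module M U). the_elem (g ` A))"

context
  fixes k :: "('r, 'm) ring_scheme" and M :: "('r, 'a) module" and N :: "('r, 'b) module"
    and U :: "'a set" and g :: "'a \<Rightarrow> 'b"
  assumes M: "module k M" and N: "module k N" and U: "submodule U k M"
    and g: "g \<in> linear_maps k M N" and vanish: "\<And>u. u \<in> U \<Longrightarrow> g u = \<zero>\<^bsub>N\<^esub>"
begin

lemma quot_lift_coset:
  assumes x: "x \<in> carrier M"
  shows "quot_lift M U g (U +>\<^bsub>M\<^esub> x) = g x"
proof -
  interpret N: module k N by (rule N)
  interpret U: abelian_subgroup U M by (rule submodule_imp_abelian_subgroup[OF M U])
  have "g y = g x" if y: "y \<in> U +>\<^bsub>M\<^esub> x" for y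
  proof -
    obtain u where u: "u \<in> U" "y = u \<oplus>\<^bsub>M\<^esub> x" using y by (auto simp: a_r_coset_def')
    then show ?thesis
      using linear_mapsD(1,2)[OF g] x U.a_subset vanish by (auto simp: subset_iff)
  qed
  then have "g ` (U +>\<^bsub>M\<^esub> x) = {g x}" using U.a_rcos_self[OF x] by blast
  then show ?thesis using x by (simp add: quot_lift_def quot_module_carrier[OF M U])
qed

lemma quot_lift_linear: "quot_lift M U g \<in> linear_maps k (quot_module M U) N"
  by (rule linear_map_quotI[OF M U g]) (simp_all add: quot_lift_coset, simp add: quot_lift_def)

end

section \<open>Cokernels of representations\<close>

lemma quiver_repD:
  assumes "quiver_rep k Q M"
  shows "i \<in> verts Q \<Longrightarrow> module k (space_at M i)"
    and "\<alpha> \<in> arcs Q \<Longrightarrow> map_at M \<alpha> \<in> linear_maps k (space_at M (tail Q \<alpha>)) (space_at M (head Q \<alpha>))"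
  using assms by (auto simp: quiver_rep_def)

lemma rep_homD:
  assumes "f \<in> rep_hom k Q M N"
  shows "i \<in> verts Q \<Longrightarrow> f i \<in> linear_maps k (space_at M i) (space_at N i)"
    and "\<alpha> \<in> arcs Q \<Longrightarrow> x \<in> carrier (space_at M (tail Q \<alpha>)) \<Longrightarrow>
           f (head Q \<alpha>) (map_at M \<alpha> x) = map_at N \<alpha> (f (tail Q \<alpha>) x)"
    and "f \<in> extensional (verts Q)"
  using assms by (auto simp: rep_hom_def PiE_iff)

text \<open>\<open>g \<circ> f = 0\<close> iff \<open>g\<close> vanishes on the image of \<open>f\<close> at every vertex.\<close>

lemma rep_comp_eq_zero_iff:
  "rep_comp Q V g f = rep_zero Q V D \<longleftrightarrow>
     (\<forall>i\<in>verts Q. \<forall>y\<in>image_at V f i. g i y = \<zero>\<^bsub>space_at D i\<^esub>)" (is "?l \<longleftrightarrow> ?r")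
proof
  assume l: ?l
  show ?r
  proof clarify
    fix i x assume "i \<in> verts Q" "x \<in> carrier (space_at V i)"
    then show "g i (f i x) = \<zero>\<^bsub>space_at D i\<^esub>"
      using fun_cong[OF fun_cong[OF l], of i x] by (simp add: rep_comp_def rep_zero_def compose_def)
  qed
next
  assume ?r
  then show ?l by (auto simp: rep_comp_def rep_zero_def compose_def fun_eq_iff)
qed

lemma space_at_coker_rep:
  "space_at (coker_rep Q V W f) i = quot_module (space_at W i) (image_at V f i)"
  by (simp add: coker_rep_def)

lemma coker_proj_at:
  "i \<in> verts Q \<Longrightarrow> coker_proj Q V W f i =
     (\<lambda>w\<in>carrier (space_at W i). image_at V f i +>\<^bsub>space_at W i\<^esub> w)"
  by (simp add: coker_proj_def)

context
  fixes k :: "('r, 'm) ring_scheme" and Q :: "('v, 'e) pre_digraph"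
    and V :: "('v, 'e, 'r, 'a) qrep" and W :: "('v, 'e, 'r, 'b) qrep" and f :: "'v \<Rightarrow> 'a \<Rightarrow> 'b"
  assumes Q: "wf_digraph Q" and V: "quiver_rep k Q V" and W: "quiver_rep k Q W"
    and f: "f \<in> rep_hom k Q V W"
begin

interpretation Q: wf_digraph Q by (rule Q)

lemma submodule_image_at: "i \<in> verts Q \<Longrightarrow> submodule (image_at V f i) k (space_at W i)"
  by (intro linear_maps_image_submodule quiver_repD(1)[OF V] quiver_repD(1)[OF W] rep_homD(1)[OF f])

lemma map_at_image_at:
  assumes "\<alpha> \<in> arcs Q"
  shows "map_at W \<alpha> ` image_at V f (tail Q \<alpha>) \<subseteq> image_at V f (head Q \<alpha>)"
  using assms linear_mapsD(1)[OF quiver_repD(2)[OF V]] by (force simp flip: rep_homD(2)[OF f])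

lemma map_at_coker_rep_coset:
  assumes "\<alpha> \<in> arcs Q" "w \<in> carrier (space_at W (tail Q \<alpha>))"
  shows "map_at (coker_rep Q V W f) \<alpha> (image_at V f (tail Q \<alpha>) +>\<^bsub>space_at W (tail Q \<alpha>)\<^esub> w) =
         image_at V f (head Q \<alpha>) +>\<^bsub>space_at W (head Q \<alpha>)\<^esub> map_at W \<alpha> w"
  using assms unfolding coker_rep_def qrep.simps
  by (intro quot_map_coset[where k = k] quiver_repD[OF W] submodule_image_at map_at_image_at) auto

lemma quiver_rep_coker_rep: "quiver_rep k Q (coker_rep Q V W f)"
  unfolding quiver_rep_def
proof (intro conjI ballI)
  show "module k (space_at (coker_rep Q V W f) i)" if "i \<in> verts Q" for i
    unfolding space_at_coker_rep
    by (intro module_quot_module quiver_repD(1)[OF W] submodule_image_at that)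
  show "map_at (coker_rep Q V W f) \<alpha> \<in> linear_maps k (space_at (coker_rep Q V W f) (tail Q \<alpha>))
          (space_at (coker_rep Q V W f) (head Q \<alpha>))" if "\<alpha> \<in> arcs Q" for \<alpha>
    using that unfolding coker_rep_def qrep.simps
    by (intro quot_map_linear quiver_repD[OF W] submodule_image_at map_at_image_at) auto
qed

lemma coker_proj_rep_hom: "coker_proj Q V W f \<in> rep_hom k Q W (coker_rep Q V W f)"
  unfolding rep_hom_def
proof (intro CollectI conjI ballI)
  show "coker_proj Q V W f \<in> (\<Pi>\<^sub>E i\<in>verts Q. linear_maps k (space_at W i)
          (space_at (coker_rep Q V W f) i))"
  proof (rule PiE_I)
    show "coker_proj Q V W f i \<in> linear_maps k (space_at W i) (space_at (coker_rep Q V W f) i)"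
      if "i \<in> verts Q" for i
      using coset_map_linear[OF quiver_repD(1)[OF W] submodule_image_at, OF that that]
      unfolding coker_proj_at[OF that] space_at_coker_rep .
  qed (simp add: coker_proj_def)
  show "coker_proj Q V W f (head Q \<alpha>) (map_at W \<alpha> w) =
          map_at (coker_rep Q V W f) \<alpha> (coker_proj Q V W f (tail Q \<alpha>) w)"
    if "\<alpha> \<in> arcs Q" "w \<in> carrier (space_at W (tail Q \<alpha>))" for \<alpha> w
    using that linear_mapsD(1)[OF quiver_repD(2)[OF W]]
    by (simp add: coker_proj_at map_at_coker_rep_coset)
qed

lemma coker_proj_comp_zero:
  "rep_comp Q V (coker_proj Q V W f) f = rep_zero Q V (coker_rep Q V W f)"
  unfolding rep_comp_eq_zero_iff
proof (intro ballI)
  fix i y assume i: "i \<in> verts Q" and y: "y \<in> image_at V f i"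
  then have "y \<in> carrier (space_at W i)" using linear_mapsD(1)[OF rep_homD(1)[OF f i]] by auto
  then show "coker_proj Q V W f i y = \<zero>\<^bsub>space_at (coker_rep Q V W f) i\<^esub>"
    using coset_eq_quot_zero_iff[OF quiver_repD(1)[OF W i] submodule_image_at[OF i]] i y
    by (simp add: coker_proj_at space_at_coker_rep)
qed

text \<open>The projection is an epimorphism because it is surjective at every vertex.\<close>

lemma coker_proj_epi:
  assumes h: "h \<in> rep_hom k Q (coker_rep Q V W f) D" "h' \<in> rep_hom k Q (coker_rep Q V W f) D"
    and eq: "rep_comp Q W h (coker_proj Q V W f) = rep_comp Q W h' (coker_proj Q V W f)"
  shows "h = h'"
proof (rule extensionalityI)
  show "h \<in> extensional (verts Q)" "h' \<in> extensional (verts Q)" using h[THEN rep_homD(3)] .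
  fix i assume i: "i \<in> verts Q"
  show "h i = h' i"
  proof (rule linear_map_quot_eqI[OF quiver_repD(1)[OF W i] submodule_image_at[OF i]])
    show "h i \<in> linear_maps k (quot_module (space_at W i) (image_at V f i)) (space_at D i)"
      "h' i \<in> linear_maps k (quot_module (space_at W i) (image_at V f i)) (space_at D i)"
      using h[THEN rep_homD(1), OF i] by (simp_all add: space_at_coker_rep)
    show "h i (image_at V f i +>\<^bsub>space_at W i\<^esub> w) = h' i (image_at V f i +>\<^bsub>space_at W i\<^esub> w)"
      if "w \<in> carrier (space_at W i)" for w
      using fun_cong[OF fun_cong[OF eq], of i w] i that
      by (simp add: rep_comp_def compose_def coker_proj_at)
  qed
qed

text \<open>
  The universal property of the cokernel of representations. The last clause, the values of the
  factorisation on cosets, is what the compatibility with the linking maps of a birepresentation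
  rests on.
\<close>

lemma coker_rep_lift:
  assumes D: "quiver_rep k Q D" and g: "g \<in> rep_hom k Q W D"
    and zero: "rep_comp Q V g f = rep_zero Q V D"
  obtains h where "h \<in> rep_hom k Q (coker_rep Q V W f) D"
    and "g = rep_comp Q W h (coker_proj Q V W f)"
    and "\<And>i w. i \<in> verts Q \<Longrightarrow> w \<in> carrier (space_at W i) \<Longrightarrow>
           h i (image_at V f i +>\<^bsub>space_at W i\<^esub> w) = g i w"
proof
  define h where "h = (\<lambda>i\<in>verts Q. quot_lift (space_at W i) (image_at V f i) (g i))"
  have vanish: "g i y = \<zero>\<^bsub>space_at D i\<^esub>" if "i \<in> verts Q" "y \<in> image_at V f i" for i y
    using zero that unfolding rep_comp_eq_zero_iff by blast
  have linear: "h i \<in> linear_maps k (quot_module (space_at W i) (image_at V f i)) (space_at D i)"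
    if "i \<in> verts Q" for i
    using quot_lift_linear[OF quiver_repD(1)[OF W that] quiver_repD(1)[OF D that]
        submodule_image_at[OF that] rep_homD(1)[OF g that] vanish[OF that]] that
    by (simp add: h_def)
  show coset: "h i (image_at V f i +>\<^bsub>space_at W i\<^esub> w) = g i w"
    if "i \<in> verts Q" "w \<in> carrier (space_at W i)" for i w
    using quot_lift_coset[OF quiver_repD(1)[OF W that(1)] quiver_repD(1)[OF D that(1)]
        submodule_image_at[OF that(1)] rep_homD(1)[OF g that(1)] vanish[OF that(1)] that(2)] that
    by (simp add: h_def)
  show "h \<in> rep_hom k Q (coker_rep Q V W f) D"
    unfolding rep_hom_def
  proof (intro CollectI conjI ballI)
    show "h \<in> (\<Pi>\<^sub>E i\<in>verts Q. linear_maps k (space_at (coker_rep Q V W f) i) (space_at D i))"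
      using linear by (auto simp: space_at_coker_rep h_def)
    fix \<alpha> A assume \<alpha>: "\<alpha> \<in> arcs Q"
      and "A \<in> carrier (space_at (coker_rep Q V W f) (tail Q \<alpha>))"
    then obtain w where w: "w \<in> carrier (space_at W (tail Q \<alpha>))"
      "A = image_at V f (tail Q \<alpha>) +>\<^bsub>space_at W (tail Q \<alpha>)\<^esub> w"
      using quot_module_carrier[OF quiver_repD(1)[OF W] submodule_image_at]
      by (auto simp: space_at_coker_rep)
    show "h (head Q \<alpha>) (map_at (coker_rep Q V W f) \<alpha> A) = map_at D \<alpha> (h (tail Q \<alpha>) A)"
      using \<alpha> w linear_mapsD(1)[OF quiver_repD(2)[OF W \<alpha>]] rep_homD(2)[OF g]
      by (simp add: map_at_coker_rep_coset coset)
  qed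
  show "g = rep_comp Q W h (coker_proj Q V W f)"
  proof (rule extensionalityI[OF rep_homD(3)[OF g]])
    fix i assume i: "i \<in> verts Q"
    have "g i \<in> extensional (carrier (space_at W i))"
      using linear_maps_extensional[OF rep_homD(1)[OF g i]] .
    then show "g i = rep_comp Q W h (coker_proj Q V W f) i"
      using i by (intro extensionalityI[where A = "carrier (space_at W i)"])
        (auto simp: rep_comp_def coker_proj_at coset compose_def)
  qed (simp add: rep_comp_def)
qed

end

section \<open>Cokernels of birepresentations\<close>

lemma birepresentationD:
  assumes "birepresentation k Q Q' V"
  shows "quiver_rep k Q (rep1 V)" and "quiver_rep k Q' (rep2 V)"
    and "\<alpha> \<in> arcs Q \<Longrightarrow> \<beta> \<in> arcs Q' \<Longrightarrow>
      psi V \<alpha> \<beta> \<in> linear_maps k (space_at (rep1 V) (head Q \<alpha>)) (space_at (rep2 V) (tail Q' \<beta>))"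
  using assms by (auto simp: birepresentation_def)

lemma birep_homD:
  assumes "(f, f') \<in> birep_hom k Q Q' V W"
  shows "f \<in> rep_hom k Q (rep1 V) (rep1 W)" and "f' \<in> rep_hom k Q' (rep2 V) (rep2 W)"
    and "\<alpha> \<in> arcs Q \<Longrightarrow> \<beta> \<in> arcs Q' \<Longrightarrow> x \<in> carrier (space_at (rep1 V) (head Q \<alpha>)) \<Longrightarrow>
      f' (tail Q' \<beta>) (psi V \<alpha> \<beta> x) = psi W \<alpha> \<beta> (f (head Q \<alpha>) x)"
  using assms by (auto simp: birep_hom_def)

lemma coker_birep_simps:
  "rep1 (coker_birep Q Q' V W f f') = coker_rep Q (rep1 V) (rep1 W) f"
  "rep2 (coker_birep Q Q' V W f f') = coker_rep Q' (rep2 V) (rep2 W) f'"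
  by (simp_all add: coker_birep_def)

context
  fixes k :: "('r, 'm) ring_scheme"
    and Q :: "('v, 'e) pre_digraph" and Q' :: "('v2, 'e2) pre_digraph"
    and V :: "('v, 'e, 'v2, 'e2, 'r, 'a, 'a2) birep"
    and W :: "('v, 'e, 'v2, 'e2, 'r, 'b, 'b2) birep"
    and f :: "'v \<Rightarrow> 'a \<Rightarrow> 'b" and f' :: "'v2 \<Rightarrow> 'a2 \<Rightarrow> 'b2"
  assumes Q: "fin_digraph Q" and Q': "fin_digraph Q'"
    and V: "birepresentation k Q Q' V" and W: "birepresentation k Q Q' W"
    and f: "(f, f') \<in> birep_hom k Q Q' V W"
begin

interpretation Q: fin_digraph Q by (rule Q)
interpretation Q': fin_digraph Q' by (rule Q')

text \<open>The facts that instantiate the results on representations for the two components.\<close>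

lemmas part1 = Q.wf_digraph_axioms birepresentationD(1)[OF V]
  birepresentationD(1)[OF W] birep_homD(1)[OF f]
lemmas part2 = Q'.wf_digraph_axioms birepresentationD(2)[OF V]
  birepresentationD(2)[OF W] birep_homD(2)[OF f]
lemmas psi_coset = psi_coker_birep[OF Q Q' V W f]

lemma birepresentation_coker_birep: "birepresentation k Q Q' (coker_birep Q Q' V W f f')"
  unfolding birepresentation_def coker_birep_simps
proof (intro conjI ballI)
  show "quiver_rep k Q (coker_rep Q (rep1 V) (rep1 W) f)" by (rule quiver_rep_coker_rep[OF part1])
  show "quiver_rep k Q' (coker_rep Q' (rep2 V) (rep2 W) f')" by (rule quiver_rep_coker_rep[OF part2])
  fix \<alpha> \<beta> assume \<alpha>: "\<alpha> \<in> arcs Q" and \<beta>: "\<beta> \<in> arcs Q'"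
  \<comment> \<open>\<open>\<psi>'\<close> maps the image of \<open>f\<close> into that of \<open>f'\<close>, because \<open>\<psi>' (f x) = f' (\<psi> x)\<close>\<close>
  have "psi W \<alpha> \<beta> ` image_at (rep1 V) f (head Q \<alpha>) \<subseteq> image_at (rep2 V) f' (tail Q' \<beta>)"
    using \<alpha> \<beta> linear_mapsD(1)[OF birepresentationD(3)[OF V]]
    by (force simp flip: birep_homD(3)[OF f])
  then show "psi (coker_birep Q Q' V W f f') \<alpha> \<beta> \<in>
      linear_maps k (space_at (coker_rep Q (rep1 V) (rep1 W) f) (head Q \<alpha>))
        (space_at (coker_rep Q' (rep2 V) (rep2 W) f') (tail Q' \<beta>))"
    unfolding coker_birep_def coker_rep_def birep.simps qrep.simps using \<alpha> \<beta>
    by (intro quot_map_linear submodule_image_at[OF part1] submodule_image_at[OF part2]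
        quiver_repD(1)[OF part1(3)] quiver_repD(1)[OF part2(3)] birepresentationD(3)[OF W]) auto
qed

lemma coker_proj_birep_hom:
  "(coker_proj Q (rep1 V) (rep1 W) f, coker_proj Q' (rep2 V) (rep2 W) f')
     \<in> birep_hom k Q Q' W (coker_birep Q Q' V W f f')"
  unfolding birep_hom_def coker_birep_simps
proof (intro CollectI case_prodI conjI ballI)
  show "coker_proj Q (rep1 V) (rep1 W) f \<in> rep_hom k Q (rep1 W) (coker_rep Q (rep1 V) (rep1 W) f)"
    by (rule coker_proj_rep_hom[OF part1])
  show "coker_proj Q' (rep2 V) (rep2 W) f' \<in> rep_hom k Q' (rep2 W) (coker_rep Q' (rep2 V) (rep2 W) f')"
    by (rule coker_proj_rep_hom[OF part2])
  fix \<alpha> \<beta> w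
  assume "\<alpha> \<in> arcs Q" "\<beta> \<in> arcs Q'" "w \<in> carrier (space_at (rep1 W) (head Q \<alpha>))"
  then show "coker_proj Q' (rep2 V) (rep2 W) f' (tail Q' \<beta>) (psi W \<alpha> \<beta> w) =
      psi (coker_birep Q Q' V W f f') \<alpha> \<beta> (coker_proj Q (rep1 V) (rep1 W) f (head Q \<alpha>) w)"
    using linear_mapsD(1)[OF birepresentationD(3)[OF W]]
    by (simp add: coker_proj_def psi_coset)
qed

lemma coker_birep_lift:
  assumes D: "birepresentation k Q Q' D" and g: "(g, g') \<in> birep_hom k Q Q' W D"
    and zero: "birep_comp Q Q' V (g, g') (f, f') = birep_zero Q Q' V D"
  obtains h h' where "(h, h') \<in> birep_hom k Q Q' (coker_birep Q Q' V W f f') D"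
    and "g = rep_comp Q (rep1 W) h (coker_proj Q (rep1 V) (rep1 W) f)"
    and "g' = rep_comp Q' (rep2 W) h' (coker_proj Q' (rep2 V) (rep2 W) f')"
proof -
  have zero': "rep_comp Q (rep1 V) g f = rep_zero Q (rep1 V) (rep1 D)"
    "rep_comp Q' (rep2 V) g' f' = rep_zero Q' (rep2 V) (rep2 D)"
    using zero by (simp_all add: birep_comp_def birep_zero_def)
  obtain h where h: "h \<in> rep_hom k Q (coker_rep Q (rep1 V) (rep1 W) f) (rep1 D)"
    "g = rep_comp Q (rep1 W) h (coker_proj Q (rep1 V) (rep1 W) f)"
    "\<And>i w. i \<in> verts Q \<Longrightarrow> w \<in> carrier (space_at (rep1 W) i) \<Longrightarrow>
       h i (image_at (rep1 V) f i +>\<^bsub>space_at (rep1 W) i\<^esub> w) = g i w"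
    using coker_rep_lift[OF part1 birepresentationD(1)[OF D] birep_homD(1)[OF g] zero'(1)] by metis
  obtain h' where h': "h' \<in> rep_hom k Q' (coker_rep Q' (rep2 V) (rep2 W) f') (rep2 D)"
    "g' = rep_comp Q' (rep2 W) h' (coker_proj Q' (rep2 V) (rep2 W) f')"
    "\<And>i w. i \<in> verts Q' \<Longrightarrow> w \<in> carrier (space_at (rep2 W) i) \<Longrightarrow>
       h' i (image_at (rep2 V) f' i +>\<^bsub>space_at (rep2 W) i\<^esub> w) = g' i w"
    using coker_rep_lift[OF part2 birepresentationD(2)[OF D] birep_homD(2)[OF g] zero'(2)] by metis
  have "h' (tail Q' \<beta>) (psi (coker_birep Q Q' V W f f') \<alpha> \<beta> A) = psi D \<alpha> \<beta> (h (head Q \<alpha>) A)"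
    if \<alpha>: "\<alpha> \<in> arcs Q" and \<beta>: "\<beta> \<in> arcs Q'"
      and A: "A \<in> carrier (space_at (coker_rep Q (rep1 V) (rep1 W) f) (head Q \<alpha>))" for \<alpha> \<beta> A
  proof -
    obtain w where w: "w \<in> carrier (space_at (rep1 W) (head Q \<alpha>))"
      "A = image_at (rep1 V) f (head Q \<alpha>) +>\<^bsub>space_at (rep1 W) (head Q \<alpha>)\<^esub> w"
      using A \<alpha> quot_module_carrier[OF quiver_repD(1)[OF part1(3)] submodule_image_at[OF part1]]
      by (auto simp: space_at_coker_rep)
    then show ?thesis
      using \<alpha> \<beta> linear_mapsD(1)[OF birepresentationD(3)[OF W \<alpha> \<beta>]] birep_homD(3)[OF g \<alpha> \<beta>]
      by (simp add: psi_coset h(3) h'(3))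
  qed
  then have "(h, h') \<in> birep_hom k Q Q' (coker_birep Q Q' V W f f') D"
    using h(1) h'(1) by (simp add: birep_hom_def coker_birep_simps)
  then show ?thesis using h(2) h'(2) that by blast
qed

end

theorem proposition4p4:
  fixes k :: "('r, 'm) ring_scheme"
    and Q :: "('v, 'e) pre_digraph" and Q' :: "('v2, 'e2) pre_digraph"
    and V :: "('v, 'e, 'v2, 'e2, 'r, 'a, 'a2) birep"
    and W :: "('v, 'e, 'v2, 'e2, 'r, 'b, 'b2) birep"
    and f :: "'v \<Rightarrow> 'a \<Rightarrow> 'b" and f' :: "'v2 \<Rightarrow> 'a2 \<Rightarrow> 'b2"
  assumes "algebraically_closed k"
    and "finite_connected_acyclic_quiver Q" and "finite_connected_acyclic_quiver Q'"
    and "birepresentation k Q Q' V" and "birepresentation k Q Q' W"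
    and "(f, f') \<in> birep_hom k Q Q' V W"
  shows "is_birep_cokernel TYPE('d) TYPE('d2) k Q Q' V W (f, f')
           (coker_birep Q Q' V W f f')
           (coker_proj Q (rep1 V) (rep1 W) f, coker_proj Q' (rep2 V) (rep2 W) f')"
proof -
  have fin: "fin_digraph Q" "fin_digraph Q'"
    using assms(2,3) by (auto simp: finite_connected_acyclic_quiver_def)
  note setting = fin assms(4-6)
  note part1 = fin_digraph.axioms(1)[OF fin(1)] birepresentationD(1)[OF assms(4)]
    birepresentationD(1)[OF assms(5)] birep_homD(1)[OF assms(6)]
  note part2 = fin_digraph.axioms(1)[OF fin(2)] birepresentationD(2)[OF assms(4)]
    birepresentationD(2)[OF assms(5)] birep_homD(2)[OF assms(6)]
  let ?C = "coker_birep Q Q' V W f f'"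
  let ?p = "coker_proj Q (rep1 V) (rep1 W) f" and ?p' = "coker_proj Q' (rep2 V) (rep2 W) f'"
  show ?thesis
    unfolding is_birep_cokernel_def
  proof (intro conjI allI impI ballI)
    show "birepresentation k Q Q' ?C" by (rule birepresentation_coker_birep[OF setting])
    show "(?p, ?p') \<in> birep_hom k Q Q' W ?C" by (rule coker_proj_birep_hom[OF setting])
    show "birep_comp Q Q' V (?p, ?p') (f, f') = birep_zero Q Q' V ?C"
      by (simp add: birep_comp_def birep_zero_def coker_birep_def
          coker_proj_comp_zero[OF part1] coker_proj_comp_zero[OF part2])
    fix D :: "('v, 'e, 'v2, 'e2, 'r, 'd, 'd2) birep" and gg
    assume D: "birepresentation k Q Q' D" and gg: "gg \<in> birep_hom k Q Q' W D"
      and zero: "birep_comp Q Q' V gg (f, f') = birep_zero Q Q' V D"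
    obtain g g' where g: "gg = (g, g')" by (cases gg)
    obtain h h' where h: "(h, h') \<in> birep_hom k Q Q' ?C D"
      "g = rep_comp Q (rep1 W) h ?p" "g' = rep_comp Q' (rep2 W) h' ?p'"
      using coker_birep_lift[OF setting D gg[unfolded g] zero[unfolded g]] by blast
    show "\<exists>!h. h \<in> birep_hom k Q Q' ?C D \<and> gg = birep_comp Q Q' W h (?p, ?p')"
    proof (rule ex1I[of _ "(h, h')"])
      show "(h, h') \<in> birep_hom k Q Q' ?C D \<and> gg = birep_comp Q Q' W (h, h') (?p, ?p')"
        using h(1) by (simp add: g birep_comp_def flip: h(2,3))
      fix j assume j: "j \<in> birep_hom k Q Q' ?C D \<and> gg = birep_comp Q Q' W j (?p, ?p')"
      obtain j1 j2 where j12: "j = (j1, j2)" by (cases j)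
      have jhom: "(j1, j2) \<in> birep_hom k Q Q' ?C D" using j by (simp add: j12)
      have eq: "rep_comp Q (rep1 W) j1 ?p = g" "rep_comp Q' (rep2 W) j2 ?p' = g'"
        using j by (simp_all add: j12 g birep_comp_def)
      note homs = birep_homD(1,2)[OF jhom, unfolded coker_birep_simps]
        birep_homD(1,2)[OF h(1), unfolded coker_birep_simps]
      have "j1 = h"
        using coker_proj_epi[OF part1 homs(1,3)] eq(1) h(2) by simp
      moreover have "j2 = h'"
        using coker_proj_epi[OF part2 homs(2,4)] eq(2) h(3) by simp
      ultimately show "j = (h, h')" by (simp add: j12)
    qed
  qed
qed

end
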